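(* For all real numbers $a,b,c$ and every integer $n\ge 0$, $$\sum_{k=0}^n\binom{n}{k}T_k(b,c)\,a^{n-k}=T_n(a+b,c),$$ where $T_n(b,c)$ denotes the generalized central trinomial coefficient, i.e. the coefficient of $x^n$ in the expansion of $(x^2+bx+c)^n$.
   Context: Equivalently, $T_n(b,c)=\sum_{k=0}^{\lfloor n/2\rfloor}\frac{n!}{k!\,k!\,(n-2k)!}b^{n-2k}c^k$. Convention: $0^0=1$. *)

theory Defs
  imports Complex_Main "HOL-Computational_Algebra.Polynomial"
begin

text \<open>
  The generalized central trinomial coefficient: the coefficient of \<open>x ^ n\<close> in
  \<open>(x ^ 2 + b * x + c) ^ n\<close>. Coefficient lists are written in ascending order of degree.
\<close>

definition central_trinomial :: "nat \<Rightarrow> real \<Rightarrow> real \<Rightarrow> real" where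
  "central_trinomial n b c = coeff ([:c, b, 1:] ^ n) n"

end

theory Submission imports Defs begin

text \<open>
  Write \<open>x\<^sup>2 + (a + b) x + c = (x\<^sup>2 + b x + c) + a x\<close> and expand its \<open>n\<close>-th power by the binomial
  theorem: multiplication by \<open>(a x) ^ (n - k)\<close> shifts degrees, so the coefficient of \<open>x ^ n\<close> in the
  \<open>k\<close>-th summand is a multiple of the central coefficient of \<open>(x\<^sup>2 + b x + c) ^ k\<close>.
\<close>

theorem theorem3p7:
  fixes a b c :: real and n :: nat
  shows "(\<Sum>k=0..n. real (n choose k) * central_trinomial k b c * a ^ (n - k))
           = central_trinomial n (a + b) c"
proof -
  let ?P = "[:c, b, 1:]"
  \<comment> \<open>Writing \<open>a x\<close> as \<open>monom a 1\<close> keeps its powers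
    monomials.\<close>
  have split: "[:c, a + b, 1:] = ?P + monom a 1"
    by (simp add: monom_altdef)
  have "central_trinomial n (a + b) c
      = (\<Sum>k\<le>n. coeff (of_nat (n choose k) * ?P ^ k * monom a 1 ^ (n - k)) n)"
    unfolding central_trinomial_def split binomial_ring by (rule coeff_sum)
  also have "\<dots> = (\<Sum>k\<le>n. real (n choose k) * central_trinomial k b c * a ^ (n - k))"
  proof (rule sum.cong[OF refl])
    fix k assume "k \<in> {..n}"
    \<comment> \<open>Both facts serve \<open>coeff_monom_mult\<close>: the second excludes its
      default value 0, and the first makes the shifted index the exponent \<open>k\<close>, so the
      remaining coefficient is central.\<close>
    then have "n - (n - k) = k" "\<not> n < n - k" by simp_all
    moreover have "of_nat (n choose k) * ?P ^ k * monom a 1 ^ (n - k)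
        = monom (a ^ (n - k)) (n - k) * smult (real (n choose k)) (?P ^ k)"
      by (simp add: monom_power of_nat_poly mult.commute)
    ultimately show "coeff (of_nat (n choose k) * ?P ^ k * monom a 1 ^ (n - k)) n
        = real (n choose k) * central_trinomial k b c * a ^ (n - k)"
      \<comment> \<open>Deleting \<open>mult_smult_right\<close> keeps \<open>smult\<close> inside
        the product, in the shape \<open>monom _ _ * _\<close> of the shift rule.\<close>
      by (simp add: coeff_monom_mult central_trinomial_def del: mult_smult_right)
  qed
  finally show ?thesis by (simp add: atMost_atLeast0)
qed

end
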